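(* Let $n>1$ be an integer. The categories $Cat_{HW/\!\sim}$ (orbits of states of the jealous husbands problem with $n$ couples) and $Cat_{MC}$ (states of the missionaries and cannibals problem with $n$ missionaries and $n$ cannibals) are equivalent.
   Context: Boat capacity: in both problems the boat carries at most $b$ people, where $b=2$ if $n\le 3$, $b=3$ if $n\in\{4,5\}$, $b=4$ if $n\ge 6$. HW problem. Let $W=\{w_1,\dots,w_n\}$ be the set of wives, $H=\{h_1,\dots,h_n\}$ the set of husbands ($h_i$ is the husband of $w_i$), and $U=W\cup H$ ($2n$ distinct people). A subset $X\subseteq U$ is safe if either $X\cap H=\emptyset$, or for every $w_i\in X$ also $h_i\in X$. A state is a triple $(L,R,loc)$ with $L\subseteq U$, $R=U\setminus L$ (people on the left, resp. right bank), $loc\in\{left,right\}$ (the boat's location); it is admissible if both $L$ and $R$ are safe. Only admissible states are considered; $V$ is the set of all of them. A transition $(L_1,R_1,loc_1)\xrightarrow{f}(L_2,R_2,loc_2)$ between admissible states, with move $f=(B,loc_1)$, means: $loc_2\ne loc_1$, $B$ is a safe set of people with $0<|B|\le b$, and if $loc_1=left$ then $B\subseteq L_1$, $L_2=L_1\setminus B$, $R_2=R_1\cup B$, while if $loc_1=right$ then $B\subseteq R_1$, $R_2=R_1\setminus B$, $L_2=L_1\cup B$. MC problem. A pair $(c,m)$ ($c$ cannibals, $m$ missionaries) of nonnegative integers is safe if $m=0$ or $c\le m$. A state is a triple $((c,m),(n-c,n-m),loc)$ with $0\le c,m\le n$, $loc\in\{left,right\}$ (left bank, right bank, boat's location); it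 is admissible if both pairs are safe. $V'$ is the set of admissible states. A transition $(L_1',R_1',loc_1)\xrightarrow{f'}(L_2',R_2',loc_2)$ between admissible states, with move $f'=(B',loc_1)$, means: $loc_2\neq loc_1$, $B'=(c,m)$ is a safe pair with $0<c+m\le b$, and $L_2'=L_1'-B'$, $R_2'=R_1'+B'$ (componentwise) if $loc_1=left$, while $R_2'=R_1'-B'$, $L_2'=L_1'+B'$ if $loc_1=right$. Group action. For $X\subseteq U$ and $\pi\in S_n$ put $\pi X=\{w_{\pi(i)}\mid w_i\in X\}\cup\{h_{\pi(j)}\mid h_j\in X\}$; $S_n$ acts on states of HW by $\pi(L,R,loc)=(\pi L,\pi R,loc)$ and on moves by $\pi(B,loc)=(\pi B,loc)$. $S_n state$ and $S_n f$ denote the orbits of a state and of a move. Categories. A path in HW (resp. MC) is a finite sequence $state_1\xrightarrow{f_2}state_2\xrightarrow{f_3}\cdots\xrightarrow{f_k}state_k$ ($k\ge1$) of states joined by transitions (states may repeat). $Cat_{MC}$ has the states in $V'$ as objects and, as morphisms from one state to another, the paths in MC from the first to the second; composition is concatenation of paths, and the identity of a state is the path consisting of that single state. $Cat_{HW/\!\sim}$ has the orbits $S_n state$, $state\in V$, as objects; a morphism from an orbit $O$ to an orbit $O'$ is a sequence $$S_n state_1\xrightarrow{S_nf_2}S_n state_2\xrightarrow{S_nf_3}\cdots\xrightarrow{S_nf_k}S_n state_k$$ of orbits of states and orbits of moves with $S_n state_1=O$, $S_n state_k=O'$ for which there exist representatives $state_i^{(0)}\in S_n state_i$ and $f_i^{(0)}\in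 S_n f_i$ such that $state_1^{(0)}\xrightarrow{f_2^{(0)}}state_2^{(0)}\to\cdots\xrightarrow{f_k^{(0)}}state_k^{(0)}$ is a path in HW. Composition is concatenation of sequences, and the identity of an orbit is the sequence consisting of that single orbit. *)

theory Defs
  imports "HOL-Combinatorics.Permutations"
begin

text \<open>\<open>comp C g f\<close> is the composite of \<open>f\<close> followed by \<open>g\<close>.\<close>

record ('o, 'a) cat =
  obj :: "'o set"
  arr :: "'a set"
  src :: "'a \<Rightarrow> 'o"
  tgt :: "'a \<Rightarrow> 'o"
  ident :: "'o \<Rightarrow> 'a"
  comp :: "'a \<Rightarrow> 'a \<Rightarrow> 'a"

definition homset :: "('o, 'a) cat \<Rightarrow> 'o \<Rightarrow> 'o \<Rightarrow> 'a set" where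
  "homset C x y = {f \<in> arr C. src C f = x \<and> tgt C f = y}"

locale category =
  fixes C :: "('o, 'a) cat"
  assumes src_obj: "f \<in> arr C \<Longrightarrow> src C f \<in> obj C"
    and tgt_obj: "f \<in> arr C \<Longrightarrow> tgt C f \<in> obj C"
    and ident_hom: "x \<in> obj C \<Longrightarrow> ident C x \<in> homset C x x"
    and comp_hom: "f \<in> homset C x y \<Longrightarrow> g \<in> homset C y z \<Longrightarrow> comp C g f \<in> homset C x z"
    and comp_ident_right: "f \<in> homset C x y \<Longrightarrow> comp C f (ident C x) = f"
    and comp_ident_left: "f \<in> homset C x y \<Longrightarrow> comp C (ident C y) f = f"
    and comp_assoc: "f \<in> homset C w x \<Longrightarrow> g \<in> homset C x y \<Longrightarrow> h \<in> homset C y z \<Longrightarrow>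
      comp C h (comp C g f) = comp C (comp C h g) f"

definition is_iso :: "('o, 'a) cat \<Rightarrow> 'o \<Rightarrow> 'o \<Rightarrow> 'a \<Rightarrow> bool" where
  "is_iso C x y f \<longleftrightarrow> f \<in> homset C x y \<and>
    (\<exists>g \<in> homset C y x. comp C g f = ident C x \<and> comp C f g = ident C y)"

locale functor_between = source: category C + target: category D
  for C :: "('o, 'a) cat" and D :: "('p, 'b) cat" +
  fixes Fo :: "'o \<Rightarrow> 'p" and Fa :: "'a \<Rightarrow> 'b"
  assumes map_obj: "x \<in> obj C \<Longrightarrow> Fo x \<in> obj D"
    and map_hom: "f \<in> homset C x y \<Longrightarrow> Fa f \<in> homset D (Fo x) (Fo y)"
    and map_ident: "x \<in> obj C \<Longrightarrow> Fa (ident C x) = ident D (Fo x)"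
    and map_comp: "f \<in> homset C x y \<Longrightarrow> g \<in> homset C y z \<Longrightarrow>
      Fa (comp C g f) = comp D (Fa g) (Fa f)"

locale natural_iso =
  F: functor_between C D Fo Fa + G: functor_between C D Go Ga
  for C :: "('o, 'a) cat" and D :: "('p, 'b) cat"
    and Fo :: "'o \<Rightarrow> 'p" and Fa :: "'a \<Rightarrow> 'b" and Go :: "'o \<Rightarrow> 'p" and Ga :: "'a \<Rightarrow> 'b" +
  fixes \<eta> :: "'o \<Rightarrow> 'b"
  assumes component_iso: "x \<in> obj C \<Longrightarrow> is_iso D (Fo x) (Go x) (\<eta> x)"
    and naturality: "f \<in> homset C x y \<Longrightarrow> comp D (\<eta> y) (Fa f) = comp D (Ga f) (\<eta> x)"

definition equivalent_categories :: "('o, 'a) cat \<Rightarrow> ('p, 'b) cat \<Rightarrow> bool" where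
  "equivalent_categories C D \<longleftrightarrow>
    (\<exists>Fo Fa Go Ga \<eta> \<epsilon>.
      functor_between C D Fo Fa \<and> functor_between D C Go Ga \<and>
      natural_iso C C id id (Go \<circ> Fo) (Ga \<circ> Fa) \<eta> \<and>
      natural_iso D D (Fo \<circ> Go) (Fa \<circ> Ga) id id \<epsilon>)"

text \<open>The sequence \<open>s\<^sub>1 \<rightarrow> s\<^sub>2 \<rightarrow> \<dots> \<rightarrow> s\<^sub>k\<close> with labels \<open>f\<^sub>2, \<dots>, f\<^sub>k\<close> is encoded as
  \<open>(s\<^sub>1, [(f\<^sub>2, s\<^sub>2), \<dots>, (f\<^sub>k, s\<^sub>k)])\<close>.\<close>

type_synonym ('s, 'f) walk = "'s \<times> ('f \<times> 's) list"

definition walk_start :: "('s, 'f) walk \<Rightarrow> 's" where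
  "walk_start p = fst p"

definition walk_end :: "('s, 'f) walk \<Rightarrow> 's" where
  "walk_end p = last (fst p # map snd (snd p))"

definition walk_single :: "'s \<Rightarrow> ('s, 'f) walk" where
  "walk_single s = (s, [])"

text \<open>Only meaningful if \<open>p\<close> ends where \<open>q\<close> starts; the shared state is not repeated.\<close>

definition walk_concat :: "('s, 'f) walk \<Rightarrow> ('s, 'f) walk \<Rightarrow> ('s, 'f) walk" where
  "walk_concat p q = (fst p, snd p @ snd q)"

inductive is_path :: "'s set \<Rightarrow> ('s \<Rightarrow> 'f \<Rightarrow> 's \<Rightarrow> bool) \<Rightarrow> ('s, 'f) walk \<Rightarrow> bool"
  for V :: "'s set" and T :: "'s \<Rightarrow> 'f \<Rightarrow> 's \<Rightarrow> bool" where
  single: "s \<in> V \<Longrightarrow> is_path V T (s, [])"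
| step: "s \<in> V \<Longrightarrow> T s f t \<Longrightarrow> is_path V T (t, xs) \<Longrightarrow> is_path V T (s, (f, t) # xs)"

definition walk_cat :: "'s set \<Rightarrow> ('s, 'f) walk set \<Rightarrow> ('s, ('s, 'f) walk) cat" where
  "walk_cat Ob Ar = \<lparr>obj = Ob, arr = Ar, src = walk_start, tgt = walk_end,
    ident = walk_single, comp = (\<lambda>q p. walk_concat p q)\<rparr>"

datatype bank = Left | Right

definition boat_capacity :: "nat \<Rightarrow> nat" where
  "boat_capacity n = (if n \<le> 3 then 2 else if n \<le> 5 then 3 else 4)"

datatype person = Wife nat | Husband nat

type_synonym hw_state = "person set \<times> person set \<times> bank"
type_synonym hw_move = "person set \<times> bank"

definition wives :: "nat \<Rightarrow> person set" where
  "wives n = Wife ` {1..n}"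

definition husbands :: "nat \<Rightarrow> person set" where
  "husbands n = Husband ` {1..n}"

definition people :: "nat \<Rightarrow> person set" where
  "people n = wives n \<union> husbands n"

definition hw_safe :: "nat \<Rightarrow> person set \<Rightarrow> bool" where
  "hw_safe n X \<longleftrightarrow> X \<subseteq> people n \<and>
    (X \<inter> husbands n = {} \<or> (\<forall>i. Wife i \<in> X \<longrightarrow> Husband i \<in> X))"

definition hw_states :: "nat \<Rightarrow> hw_state set" where
  "hw_states n = {(L, R, loc). L \<subseteq> people n \<and> R = people n - L \<and> hw_safe n L \<and> hw_safe n R}"

definition hw_moves :: "nat \<Rightarrow> hw_move set" where
  "hw_moves n = {(B, loc). hw_safe n B \<and> 0 < card B \<and> card B \<le> boat_capacity n}"

fun hw_transition :: "nat \<Rightarrow> hw_state \<Rightarrow> hw_move \<Rightarrow> hw_state \<Rightarrow> bool" where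
  "hw_transition n (L1, R1, loc1) (B, loc) (L2, R2, loc2) \<longleftrightarrow>
    (L1, R1, loc1) \<in> hw_states n \<and> (L2, R2, loc2) \<in> hw_states n \<and>
    (B, loc) \<in> hw_moves n \<and> loc = loc1 \<and> loc2 \<noteq> loc1 \<and>
    (if loc1 = Left then B \<subseteq> L1 \<and> L2 = L1 - B \<and> R2 = R1 \<union> B
     else B \<subseteq> R1 \<and> R2 = R1 - B \<and> L2 = L1 \<union> B)"

definition act_set :: "(nat \<Rightarrow> nat) \<Rightarrow> person set \<Rightarrow> person set" where
  "act_set \<pi> X = {Wife (\<pi> i) | i. Wife i \<in> X} \<union> {Husband (\<pi> j) | j. Husband j \<in> X}"

fun act_state :: "(nat \<Rightarrow> nat) \<Rightarrow> hw_state \<Rightarrow> hw_state" where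
  "act_state \<pi> (L, R, loc) = (act_set \<pi> L, act_set \<pi> R, loc)"

fun act_move :: "(nat \<Rightarrow> nat) \<Rightarrow> hw_move \<Rightarrow> hw_move" where
  "act_move \<pi> (B, loc) = (act_set \<pi> B, loc)"

definition state_orbit :: "nat \<Rightarrow> hw_state \<Rightarrow> hw_state set" where
  "state_orbit n s = {act_state \<pi> s | \<pi>. \<pi> permutes {1..n}}"

definition move_orbit :: "nat \<Rightarrow> hw_move \<Rightarrow> hw_move set" where
  "move_orbit n f = {act_move \<pi> f | \<pi>. \<pi> permutes {1..n}}"

definition hw_state_orbits :: "nat \<Rightarrow> hw_state set set" where
  "hw_state_orbits n = state_orbit n ` hw_states n"

definition hw_move_orbits :: "nat \<Rightarrow> hw_move set set" where
  "hw_move_orbits n = move_orbit n ` hw_moves n"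

definition hw_orbit_walks :: "nat \<Rightarrow> (hw_state set, hw_move set) walk set" where
  "hw_orbit_walks n = {(Q, Ps).
    Q \<in> hw_state_orbits n \<and> set Ps \<subseteq> hw_move_orbits n \<times> hw_state_orbits n \<and>
    (\<exists>s xs. is_path (hw_states n) (hw_transition n) (s, xs) \<and>
      s \<in> Q \<and> list_all2 (\<lambda>(f, t) (F, T). f \<in> F \<and> t \<in> T) xs Ps)}"

definition Cat_HW_orbits ::
  "nat \<Rightarrow> (hw_state set, (hw_state set, hw_move set) walk) cat" where
  "Cat_HW_orbits n = walk_cat (hw_state_orbits n) (hw_orbit_walks n)"

text \<open>Pairs are \<open>(c, m)\<close>: cannibals first, missionaries second.\<close>

type_synonym mc_state = "(nat \<times> nat) \<times> (nat \<times> nat) \<times> bank"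
type_synonym mc_move = "(nat \<times> nat) \<times> bank"

fun mc_safe :: "nat \<times> nat \<Rightarrow> bool" where
  "mc_safe (c, m) \<longleftrightarrow> m = 0 \<or> c \<le> m"

definition mc_states :: "nat \<Rightarrow> mc_state set" where
  "mc_states n = {((c, m), (n - c, n - m), loc) | c m loc.
    c \<le> n \<and> m \<le> n \<and> mc_safe (c, m) \<and> mc_safe (n - c, n - m)}"

definition mc_moves :: "nat \<Rightarrow> mc_move set" where
  "mc_moves n = {((c, m), loc) | c m loc. mc_safe (c, m) \<and> 0 < c + m \<and> c + m \<le> boat_capacity n}"

text \<open>The conjuncts \<open>c \<le> _ \<and> m \<le> _\<close> make the truncated subtraction on \<^typ>\<open>nat\<close> agree with
  integer subtraction.\<close>

fun mc_transition :: "nat \<Rightarrow> mc_state \<Rightarrow> mc_move \<Rightarrow> mc_state \<Rightarrow> bool" where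
  "mc_transition n ((cL1, mL1), (cR1, mR1), loc1) ((c, m), loc) ((cL2, mL2), (cR2, mR2), loc2) \<longleftrightarrow>
    ((cL1, mL1), (cR1, mR1), loc1) \<in> mc_states n \<and>
    ((cL2, mL2), (cR2, mR2), loc2) \<in> mc_states n \<and>
    ((c, m), loc) \<in> mc_moves n \<and> loc = loc1 \<and> loc2 \<noteq> loc1 \<and>
    (if loc1 = Left
     then c \<le> cL1 \<and> m \<le> mL1 \<and>
       (cL2, mL2) = (cL1 - c, mL1 - m) \<and> (cR2, mR2) = (cR1 + c, mR1 + m)
     else c \<le> cR1 \<and> m \<le> mR1 \<and>
       (cR2, mR2) = (cR1 - c, mR1 - m) \<and> (cL2, mL2) = (cL1 + c, mL1 + m))"

definition Cat_MC :: "nat \<Rightarrow> (mc_state, (mc_state, mc_move) walk) cat" where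
  "Cat_MC n = walk_cat (mc_states n) {p. is_path (mc_states n) (mc_transition n) p}"

end

theory Submission
  imports Defs
begin

text \<open>Counting wives and husbands sends safe sets to safe pairs and is equivariant. A safe set is
  a set of wives or has its wives' indices among its husbands' indices, so \<open>S\<^sub>n\<close> acts transitively on
  the safe sets with given head counts: orbits of states and moves are exactly the fibres of the
  head count. Every transition of MC lifts to a transition of HW from any prescribed state above
  its source, so the orbit walks are precisely the relabelled MC paths, and the two categories are
  even isomorphic.\<close>

section \<open>Isomorphisms of categories\<close>

lemma functor_between_id: "category C \<Longrightarrow> functor_between C C id id"
  by (simp add: functor_between_def functor_between_axioms_def)

lemma functor_between_comp:
  assumes "functor_between C D Fo Fa" "functor_between D E Go Ga"
  shows "functor_between C E (Go \<circ> Fo) (Ga \<circ> Fa)"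
proof -
  interpret F: functor_between C D Fo Fa by fact
  interpret G: functor_between D E Go Ga by fact
  show ?thesis
    by unfold_locales
      (simp_all add: F.map_obj G.map_obj F.map_hom G.map_hom F.map_ident G.map_ident
        F.map_comp G.map_comp[OF F.map_hom F.map_hom])
qed

lemma (in category) ident_iso: "x \<in> obj C \<Longrightarrow> is_iso C x x (ident C x)"
  unfolding is_iso_def using ident_hom comp_ident_left by blast

text \<open>Functions in HOL are total, so a round trip of functors can be the identity on objects
  and arrows of \<open>C\<close> only; identity arrows still serve as components.\<close>

lemma natural_iso_ident:
  assumes "functor_between C D Fo Fa" "functor_between C D Go Ga"
    and Fo_eq: "\<And>x. x \<in> obj C \<Longrightarrow> Fo x = Go x"
    and Fa_eq: "\<And>f. f \<in> arr C \<Longrightarrow> Fa f = Ga f"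
  shows "natural_iso C D Fo Fa Go Ga (\<lambda>x. ident D (Fo x))"
proof -
  interpret F: functor_between C D Fo Fa by fact
  interpret G: functor_between C D Go Ga by fact
  show ?thesis
  proof unfold_locales
    fix x assume "x \<in> obj C"
    then show "is_iso D (Fo x) (Go x) (ident D (Fo x))"
      using F.target.ident_iso F.map_obj Fo_eq by metis
  next
    fix f x y assume f: "f \<in> homset C x y"
    then have "f \<in> arr C" by (simp add: homset_def)
    then show "comp D (ident D (Fo y)) (Fa f) = comp D (Ga f) (ident D (Fo x))"
      using F.map_hom[OF f] F.target.comp_ident_left F.target.comp_ident_right Fa_eq by metis
  qed
qed

lemma equivalent_categories_inverse_functors:
  assumes F: "functor_between C D Fo Fa" and G: "functor_between D C Go Ga"
    and "\<And>x. x \<in> obj C \<Longrightarrow> Go (Fo x) = x" "\<And>f. f \<in> arr C \<Longrightarrow> Ga (Fa f) = f"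
    and "\<And>y. y \<in> obj D \<Longrightarrow> Fo (Go y) = y" "\<And>g. g \<in> arr D \<Longrightarrow> Fa (Ga g) = g"
  shows "equivalent_categories C D"
proof -
  have C: "functor_between C C id id" and D: "functor_between D D id id"
    using F unfolding functor_between_def[of C D] by (auto intro: functor_between_id)
  have "natural_iso C C id id (Go \<circ> Fo) (Ga \<circ> Fa) (\<lambda>x. ident C (id x))"
    by (rule natural_iso_ident[OF C functor_between_comp[OF F G]]) (simp_all add: assms)
  moreover have "natural_iso D D (Fo \<circ> Go) (Fa \<circ> Ga) id id (\<lambda>y. ident D ((Fo \<circ> Go) y))"
    by (rule natural_iso_ident[OF functor_between_comp[OF G F] D]) (simp_all add: assms)
  ultimately show ?thesis
    unfolding equivalent_categories_def using F G by blast
qed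

section \<open>Relabelling walks\<close>

definition map_walk :: "('s \<Rightarrow> 't) \<Rightarrow> ('f \<Rightarrow> 'g) \<Rightarrow> ('s, 'f) walk \<Rightarrow> ('t, 'g) walk" where
  "map_walk fs fm = map_prod fs (map (map_prod fm fs))"

definition walks_in :: "'s set \<Rightarrow> 'f set \<Rightarrow> ('s, 'f) walk set" where
  "walks_in S M = {(s, xs). s \<in> S \<and> set xs \<subseteq> M \<times> S}"

lemma walk_start_map [simp]: "walk_start (map_walk fs fm p) = fs (walk_start p)"
  by (simp add: walk_start_def map_walk_def)

lemma walk_end_map [simp]: "walk_end (map_walk fs fm p) = fs (walk_end p)"
  by (cases p) (auto simp: walk_end_def map_walk_def last_map o_def)

lemma map_walk_single [simp]: "map_walk fs fm (walk_single s) = walk_single (fs s)"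
  by (simp add: walk_single_def map_walk_def)

lemma map_walk_concat:
  "map_walk fs fm (walk_concat p q) = walk_concat (map_walk fs fm p) (map_walk fs fm q)"
  by (simp add: walk_concat_def map_walk_def)

lemma map_walk_map_walk:
  "map_walk gs gm (map_walk fs fm p) = map_walk (gs \<circ> fs) (gm \<circ> fm) p"
  by (cases p) (simp add: map_walk_def map_prod.comp)

lemma map_walk_idI:
  assumes "p \<in> walks_in S M" "\<And>s. s \<in> S \<Longrightarrow> fs s = s" "\<And>m. m \<in> M \<Longrightarrow> fm m = m"
  shows "map_walk fs fm p = p"
  using assms by (cases p) (auto simp: walks_in_def map_walk_def intro!: map_idI)

lemma walk_end_concat: "walk_end p = walk_start q \<Longrightarrow> walk_end (walk_concat p q) = walk_end q"
  by (cases p; cases q) (auto simp: walk_end_def walk_start_def walk_concat_def)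

lemma walk_end_in: "p \<in> walks_in S M \<Longrightarrow> walk_end p \<in> S"
proof (cases p)
  case (Pair s xs)
  assume "p \<in> walks_in S M"
  then have "set (s # map snd xs) \<subseteq> S" using Pair by (auto simp: walks_in_def)
  then show ?thesis using Pair last_in_set[of "s # map snd xs"] by (auto simp: walk_end_def)
qed

text \<open>Associativity and the unit laws are those of list append; membership in
  \<open>walks_in\<close> places both endpoints among the objects.\<close>

lemma category_walk_cat:
  assumes sub: "A \<subseteq> walks_in S M"
    and single: "\<And>s. s \<in> S \<Longrightarrow> walk_single s \<in> A"
    and concat: "\<And>p q. p \<in> A \<Longrightarrow> q \<in> A \<Longrightarrow> walk_end p = walk_start q \<Longrightarrow> walk_concat p q \<in> A"
  shows "category (walk_cat S A)"
proof unfold_locales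
  fix f assume "f \<in> arr (walk_cat S A)"
  then have "f \<in> walks_in S M" using sub by (auto simp: walk_cat_def)
  then show "src (walk_cat S A) f \<in> obj (walk_cat S A)" "tgt (walk_cat S A) f \<in> obj (walk_cat S A)"
    by (auto simp: walk_cat_def walk_end_in) (auto simp: walks_in_def walk_start_def)
next
  fix f g x y z
  assume "f \<in> homset (walk_cat S A) x y" "g \<in> homset (walk_cat S A) y z"
  then show "comp (walk_cat S A) g f \<in> homset (walk_cat S A) x z"
    by (auto simp: homset_def walk_cat_def concat walk_end_concat)
      (simp add: walk_start_def walk_concat_def)
next
  fix x assume "x \<in> obj (walk_cat S A)"
  then show "ident (walk_cat S A) x \<in> homset (walk_cat S A) x x"
    using single[of x] by (simp add: homset_def walk_cat_def walk_single_def walk_start_def walk_end_def)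
qed (auto simp: homset_def walk_cat_def walk_single_def walk_concat_def walk_start_def)

text \<open>Injectivity on states and labels lets \<open>inv_into\<close> undo the relabelling walk
  by walk, which gives mutually inverse functors.\<close>

lemma equivalent_relabelled_walk_cat:
  assumes sub: "A \<subseteq> walks_in S M"
    and single: "\<And>s. s \<in> S \<Longrightarrow> walk_single s \<in> A"
    and concat: "\<And>p q. p \<in> A \<Longrightarrow> q \<in> A \<Longrightarrow> walk_end p = walk_start q \<Longrightarrow> walk_concat p q \<in> A"
    and injs: "inj_on fs S" and injm: "inj_on fm M"
  shows "equivalent_categories (walk_cat (fs ` S) (map_walk fs fm ` A)) (walk_cat S A)"
    (is "equivalent_categories ?C ?D")
proof -
  define gs gm where "gs = inv_into S fs" and "gm = inv_into M fm"
  have gs: "gs (fs s) = s" if "s \<in> S" for s using injs that by (simp add: gs_def)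
  have gm: "gm (fm m) = m" if "m \<in> M" for m using injm that by (simp add: gm_def)
  have gw: "map_walk gs gm (map_walk fs fm p) = p" if "p \<in> A" for p
    using that sub by (auto simp: map_walk_map_walk gs gm intro!: map_walk_idI[of _ S M])
  have ends: "walk_start p \<in> S" "walk_end p \<in> S" if "p \<in> A" for p
    using that sub walk_end_in[of p S M] by (auto simp: walks_in_def walk_start_def)
  have D: "category ?D" by (rule category_walk_cat[OF sub single concat])
  have C: "category ?C"
  proof (rule category_walk_cat)
    show "map_walk fs fm ` A \<subseteq> walks_in (fs ` S) (fm ` M)"
      using sub by (fastforce simp: walks_in_def map_walk_def)
    show "walk_single s \<in> map_walk fs fm ` A" if "s \<in> fs ` S" for s
      using that single by (metis image_iff map_walk_single)
    fix p q assume pq: "p \<in> map_walk fs fm ` A" "q \<in> map_walk fs fm ` A" "walk_end p = walk_start q"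
    then obtain p' q' where p': "p' \<in> A" "p = map_walk fs fm p'" and q': "q' \<in> A" "q = map_walk fs fm q'"
      by blast
    \<comment> \<open>By injectivity on states, images that can be composed come from walks that can
      be composed; so the image of \<open>A\<close> is closed under concatenation.\<close>
    with pq(3) have "walk_end p' = walk_start q'"
      using ends(2)[OF p'(1)] ends(1)[OF q'(1)] injs by (simp add: inj_on_eq_iff)
    then have "walk_concat p' q' \<in> A" using concat p' q' by blast
    then show "walk_concat p q \<in> map_walk fs fm ` A"
      unfolding p' q' map_walk_concat[symmetric] by (rule imageI)
  qed
  have F: "functor_between ?C ?D gs (map_walk gs gm)"
    using C D
    by (auto simp: functor_between_def functor_between_axioms_def)
      (auto simp: homset_def walk_cat_def gs gw map_walk_concat)
  have G: "functor_between ?D ?C fs (map_walk fs fm)"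
    using C D
    by (auto simp: functor_between_def functor_between_axioms_def)
      (auto simp: homset_def walk_cat_def map_walk_concat)
  show ?thesis
    by (rule equivalent_categories_inverse_functors[OF F G]) (auto simp: walk_cat_def gs gw)
qed

section \<open>Concatenation, images and lifts of paths\<close>

lemma is_path_concat:
  assumes "is_path V T p" "is_path V T q" "walk_end p = walk_start q"
  shows "is_path V T (walk_concat p q)"
  using assms
proof (induction rule: is_path.induct)
  case (single s)
  then show ?case by (cases q) (simp add: walk_end_def walk_start_def walk_concat_def)
next
  case (step s f t xs)
  then have "is_path V T (walk_concat (t, xs) q)" by (auto simp: walk_end_def split: if_splits)
  then show ?case using step by (auto simp: walk_concat_def intro: is_path.step)
qed

lemma is_path_start: "is_path V T p \<Longrightarrow> fst p \<in> V"
  by (induction rule: is_path.induct) auto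

lemma is_path_walks_in:
  assumes "\<And>s f t. T s f t \<Longrightarrow> f \<in> M" and "is_path V T p"
  shows "p \<in> walks_in V M"
  using assms(2)
  by (induction rule: is_path.induct) (auto simp: walks_in_def assms(1) dest: is_path_start)

lemma is_path_map_walk:
  assumes "\<And>s. s \<in> V \<Longrightarrow> fs s \<in> V'" "\<And>s f t. T s f t \<Longrightarrow> T' (fs s) (fm f) (fs t)"
    and "is_path V T p"
  shows "is_path V' T' (map_walk fs fm p)"
  using assms(3) by (induction rule: is_path.induct) (auto simp: map_walk_def assms(1,2) intro: is_path.intros)

text \<open>Transitions are lifted one after another, each from the endpoint of the previous lift.
  As that endpoint is dictated, \<open>lift\<close> is required at every state above the source, and
  the induction keeps \<open>s\<close> arbitrary.\<close>

lemma is_path_lift: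
  assumes lift: "\<And>s f t'. s \<in> V \<Longrightarrow> T' (fs s) f t' \<Longrightarrow> \<exists>g t. T s g t \<and> t \<in> V \<and> fm g = f \<and> fs t = t'"
    and "is_path V' T' p" "s \<in> V" "fs s = fst p"
  shows "\<exists>xs. is_path V T (s, xs) \<and> map_walk fs fm (s, xs) = p"
  using assms(2-)
proof (induction arbitrary: s rule: is_path.induct)
  case (single s')
  then show ?case by (auto simp: map_walk_def intro!: exI[of _ "[]"] is_path.single)
next
  case (step s' f t' xs')
  then obtain g t where "T s g t" "t \<in> V" "fm g = f" "fs t = t'" using lift by fastforce
  moreover from this step.IH[of t] obtain xs where "is_path V T (t, xs)" "map_walk fs fm (t, xs) = (t', xs')"
    by auto
  ultimately show ?case using step.prems
    by (auto simp: map_walk_def intro!: exI[of _ "(g, t) # xs"] is_path.step)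
qed

section \<open>Head counts\<close>

text \<open>Wives come first, so they play the cannibals and husbands the missionaries.\<close>

definition head_count :: "person set \<Rightarrow> nat \<times> nat" where
  "head_count X = (card (Wife -` X), card (Husband -` X))"

fun count_state :: "hw_state \<Rightarrow> mc_state" where
  "count_state (L, R, loc) = (head_count L, head_count R, loc)"

fun count_move :: "hw_move \<Rightarrow> mc_move" where
  "count_move (B, loc) = (head_count B, loc)"

text \<open>Every person is a wife or a husband; this reduces claims about people to claims about
  sets of indices.\<close>

lemma person_set_eqI: "Wife -` X = Wife -` Y \<Longrightarrow> Husband -` X = Husband -` Y \<Longrightarrow> X = Y"
  by (auto simp: set_eq_iff vimage_def) (metis person.exhaust)+

lemma person_subsetI: "Wife -` X \<subseteq> Wife -` Y \<Longrightarrow> Husband -` X \<subseteq> Husband -` Y \<Longrightarrow> X \<subseteq> Y"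
  by (metis person_set_eqI vimage_Un sup.absorb_iff2)

lemma vimage_people [simp]: "Wife -` people n = {1..n}" "Husband -` people n = {1..n}"
  by (auto simp: people_def wives_def husbands_def)

lemma subset_people_iff: "X \<subseteq> people n \<longleftrightarrow> Wife -` X \<subseteq> {1..n} \<and> Husband -` X \<subseteq> {1..n}"
  by (metis person_subsetI vimage_mono vimage_people)

lemma finite_vimage_people:
  assumes "X \<subseteq> people n"
  shows "finite (Wife -` X)" "finite (Husband -` X)"
  using assms by (auto simp: subset_people_iff intro: finite_subset)

text \<open>Inside \<open>people n\<close> all husbands belong to \<open>husbands n\<close>, so
  safety turns into an inclusion between index sets, the form that suits permutations.\<close>

lemma hw_safe_iff:
  "hw_safe n X \<longleftrightarrow> X \<subseteq> people n \<and> (Husband -` X = {} \<or> Wife -` X \<subseteq> Husband -` X)"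
proof -
  have "X \<inter> husbands n = {} \<longleftrightarrow> Husband -` X = {}" if "X \<subseteq> people n"
    using that by (fastforce simp: people_def wives_def husbands_def)
  then show ?thesis by (auto simp: hw_safe_def)
qed

text \<open>Links the two boat limits: HW bounds the size of the load, MC the sum of its
  counts.\<close>

lemma card_head_count:
  assumes "X \<subseteq> people n"
  shows "card X = fst (head_count X) + snd (head_count X)"
proof -
  have X: "X = Wife ` (Wife -` X) \<union> Husband ` (Husband -` X)"
    by (rule person_set_eqI) auto
  have "finite (Wife -` X)" "finite (Husband -` X)"
    using assms by (rule finite_vimage_people)+
  then have "card (Wife ` (Wife -` X) \<union> Husband ` (Husband -` X)) = card (Wife -` X) + card (Husband -` X)"
    by (subst card_Un_disjoint) (auto simp: card_image inj_on_def simp del: image_vimage_eq)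
  then show ?thesis unfolding X[symmetric] by (simp add: head_count_def)
qed

lemma head_count_mono:
  assumes "Y \<subseteq> X" "X \<subseteq> people n"
  shows "fst (head_count Y) \<le> fst (head_count X)" "snd (head_count Y) \<le> snd (head_count X)"
  using assms by (auto simp: head_count_def subset_people_iff intro!: card_mono intro: finite_subset)

lemma head_count_Diff:
  assumes "Y \<subseteq> X" "X \<subseteq> people n"
  shows "head_count (X - Y) = (fst (head_count X) - fst (head_count Y), snd (head_count X) - snd (head_count Y))"
  using finite_vimage_people[OF subset_trans[OF assms]]
  by (simp add: head_count_def vimage_Diff card_Diff_subset vimage_mono[OF assms(1)])

lemma head_count_people: "head_count (people n) = (n, n)"
  by (simp add: head_count_def)

lemma head_count_Un:
  assumes "X \<inter> Y = {}" "X \<subseteq> people n" "Y \<subseteq> people n"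
  shows "head_count (X \<union> Y) = (fst (head_count X) + fst (head_count Y), snd (head_count X) + snd (head_count Y))"
  using finite_vimage_people[OF assms(2)] finite_vimage_people[OF assms(3)] assms(1)
  by (simp add: head_count_def vimage_Un card_Un_disjoint flip: vimage_Int)

lemma mc_safe_head_count: "hw_safe n X \<Longrightarrow> mc_safe (head_count X)"
  by (auto simp: hw_safe_iff head_count_def subset_people_iff intro!: card_mono intro: finite_subset)

text \<open>Initial segments are nested, so inclusions of index sets become inequalities of counts.
  Safety of the complement is conditional so that the lemma serves states, with two banks, as well
  as moves.\<close>

lemma ex_safe_set:
  assumes "mc_safe (c, m)" "c \<le> n" "m \<le> n"
  shows "\<exists>X. hw_safe n X \<and> (mc_safe (n - c, n - m) \<longrightarrow> hw_safe n (people n - X)) \<and> head_count X = (c, m)"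
proof (intro exI conjI impI)
  let ?X = "Wife ` {1..c} \<union> Husband ` {1..m}"
  have v: "Wife -` ?X = {1..c}" "Husband -` ?X = {1..m}" by auto
  show "hw_safe n ?X" using assms unfolding hw_safe_iff subset_people_iff v by auto
  show "head_count ?X = (c, m)" unfolding head_count_def v by simp
  assume "mc_safe (n - c, n - m)"
  \<comment> \<open>Either all husbands are in \<open>?X\<close>, or each wife outside it has her
    husband outside too.\<close>
  then have "m = n \<or> m \<le> c" using assms by auto
  then show "hw_safe n (people n - ?X)"
    unfolding hw_safe_iff subset_people_iff vimage_Diff vimage_people v by auto
qed

text \<open>The chain cuts \<open>N\<close> into \<open>A\<close>, \<open>B - A\<close> and
  \<open>N - B\<close>, which match the primed blocks in size; bijections between the blocks are
  glued.\<close>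

lemma permutes_extending_chain:
  assumes "finite N" "A \<subseteq> B" "B \<subseteq> N" "A' \<subseteq> B'" "B' \<subseteq> N" "card A = card A'" "card B = card B'"
  shows "\<exists>\<pi>. \<pi> permutes N \<and> \<pi> ` A = A' \<and> \<pi> ` B = B'"
proof -
  have fin: "finite B" "finite B'" "finite A" "finite A'"
    using assms by (meson finite_subset)+
  obtain f where f: "bij_betw f A A'"
    using finite_same_card_bij[OF fin(3,4)] assms by blast
  obtain g where g: "bij_betw g (B - A) (B' - A')"
    using finite_same_card_bij[of "B - A" "B' - A'"] assms fin by (auto simp: card_Diff_subset)
  obtain h where h: "bij_betw h (N - B) (N - B')"
    using finite_same_card_bij[of "N - B" "N - B'"] assms fin by (auto simp: card_Diff_subset)
  \<comment> \<open>The final default is the identity because \<open>permutes\<close> fixes every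
    point outside \<open>N\<close>.\<close>
  define \<pi> where "\<pi> x = (if x \<in> A then f x else if x \<in> B then g x else if x \<in> N then h x else x)" for x
  have 1: "bij_betw \<pi> A A'" using f by (rule bij_betw_cong[THEN iffD1, rotated]) (simp add: \<pi>_def)
  have "bij_betw \<pi> (B - A) (B' - A')" using g by (rule bij_betw_cong[THEN iffD1, rotated]) (simp add: \<pi>_def)
  from bij_betw_combine[OF 1 this] have 2: "bij_betw \<pi> B B'"
    using assms by (auto simp: Un_absorb1)
  have "bij_betw \<pi> (N - B) (N - B')" using h
    by (rule bij_betw_cong[THEN iffD1, rotated]) (use assms in \<open>auto simp: \<pi>_def\<close>)
  from bij_betw_combine[OF 2 this] have 3: "bij_betw \<pi> N N"
    using assms by (auto simp: Un_absorb1)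
  have "\<pi> permutes N"
    by (rule bij_imp_permutes[OF 3]) (use assms in \<open>auto simp: \<pi>_def\<close>)
  with 1 2 show ?thesis using bij_betw_imp_surj_on by blast
qed

section \<open>Orbits are fibres of the head count\<close>

lemma vimage_act_set [simp]:
  "Wife -` act_set \<pi> X = \<pi> ` (Wife -` X)" "Husband -` act_set \<pi> X = \<pi> ` (Husband -` X)"
  by (auto simp: act_set_def)

lemma act_set_people_Diff:
  assumes "\<pi> permutes {1..n}"
  shows "act_set \<pi> (people n - X) = people n - act_set \<pi> X"
  using assms
  by (intro person_set_eqI) (simp_all add: vimage_Diff image_set_diff permutes_inj permutes_image)

lemma act_set_subset_people_iff:
  assumes "\<pi> permutes {1..n}"
  shows "act_set \<pi> X \<subseteq> people n \<longleftrightarrow> X \<subseteq> people n"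
  using permutes_in_image[OF assms] unfolding subset_people_iff vimage_act_set by blast

lemma hw_safe_act_set:
  assumes "\<pi> permutes {1..n}"
  shows "hw_safe n (act_set \<pi> X) \<longleftrightarrow> hw_safe n X"
  using assms by (simp add: hw_safe_iff act_set_subset_people_iff inj_image_subset_iff permutes_inj)

lemma head_count_act_set:
  assumes "\<pi> permutes {1..n}"
  shows "head_count (act_set \<pi> X) = head_count X"
  using inj_on_subset[OF permutes_inj[OF assms]] by (simp add: head_count_def card_image)

text \<open>One permutation moves wives and husbands together, so for arbitrary sets the number of
  complete couples would be a further invariant. Safety removes it: either there are no husbands, or
  the index sets form a chain for \<open>permutes_extending_chain\<close>.\<close>

lemma ex_permutes_act_set:
  assumes "hw_safe n X" "hw_safe n Y" "head_count X = head_count Y"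
  shows "\<exists>\<pi>. \<pi> permutes {1..n} \<and> act_set \<pi> X = Y"
proof -
  have sub: "Wife -` X \<subseteq> {1..n}" "Husband -` X \<subseteq> {1..n}" "Wife -` Y \<subseteq> {1..n}" "Husband -` Y \<subseteq> {1..n}"
    using assms by (auto simp: hw_safe_iff subset_people_iff)
  then have fin: "finite (Husband -` X)" "finite (Husband -` Y)"
    by (auto intro: finite_subset)
  have card: "card (Wife -` X) = card (Wife -` Y)" "card (Husband -` X) = card (Husband -` Y)"
    using assms by (auto simp: head_count_def)
  have "\<exists>\<pi>. \<pi> permutes {1..n} \<and> \<pi> ` (Wife -` X) = Wife -` Y \<and> \<pi> ` (Husband -` X) = Husband -` Y"
  proof (cases "Husband -` X = {}")
    case True
    with card fin have Y: "Husband -` Y = {}" by simp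
    \<comment> \<open>Degenerate chain: the wives' indices serve as both of its terms.\<close>
    have "\<exists>\<pi>. \<pi> permutes {1..n} \<and> \<pi> ` (Wife -` X) = Wife -` Y \<and> \<pi> ` (Wife -` X) = Wife -` Y"
      by (rule permutes_extending_chain) (use sub card in simp_all)
    then show ?thesis by (simp only: True Y image_empty simp_thms)
  next
    case False
    with card fin have "Husband -` Y \<noteq> {}" by (metis card_0_eq)
    with False assms(1,2) have "Wife -` X \<subseteq> Husband -` X" "Wife -` Y \<subseteq> Husband -` Y"
      by (simp_all only: hw_safe_iff simp_thms)
    then show ?thesis
      by (intro permutes_extending_chain) (use sub card in simp_all)
  qed
  then show ?thesis by (metis person_set_eqI vimage_act_set)
qed

text \<open>Permutations preserve safety, complements and counts. Conversely, a permutation matching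
  the left banks also matches the right ones, which are their complements.\<close>

lemma state_orbit_eq:
  assumes "s \<in> hw_states n"
  shows "state_orbit n s = {t \<in> hw_states n. count_state t = count_state s}"
proof (intro equalityI subsetI)
  fix t assume "t \<in> state_orbit n s"
  then obtain \<pi> where \<pi>: "\<pi> permutes {1..n}" "t = act_state \<pi> s"
    by (auto simp: state_orbit_def)
  obtain L R l where s: "s = (L, R, l)" by (cases s)
  with assms have L: "L \<subseteq> people n" "R = people n - L" "hw_safe n L" "hw_safe n R"
    by (auto simp: hw_states_def)
  have "act_set \<pi> R = people n - act_set \<pi> L"
    using act_set_people_Diff[OF \<pi>(1)] L by simp
  moreover have "act_set \<pi> L \<subseteq> people n" "hw_safe n (act_set \<pi> L)" "hw_safe n (act_set \<pi> R)"
    using L act_set_subset_people_iff[OF \<pi>(1)] hw_safe_act_set[OF \<pi>(1)] by blast+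
  ultimately have "t \<in> hw_states n" unfolding \<pi>(2) s hw_states_def by simp
  then show "t \<in> {t \<in> hw_states n. count_state t = count_state s}"
    unfolding \<pi>(2) s by (simp add: head_count_act_set[OF \<pi>(1)])
next
  fix t assume t: "t \<in> {t \<in> hw_states n. count_state t = count_state s}"
  obtain L R l where s: "s = (L, R, l)" by (cases s)
  obtain L' R' l' where t': "t = (L', R', l')" by (cases t)
  have st: "hw_safe n L" "hw_safe n L'" "head_count L = head_count L'" "R = people n - L"
    "R' = people n - L'" "l = l'"
    using assms t by (auto simp: hw_states_def s t')
  then obtain \<pi> where "\<pi> permutes {1..n}" "act_set \<pi> L = L'"
    using ex_permutes_act_set by blast
  then show "t \<in> state_orbit n s"
    using st by (auto simp: state_orbit_def s t' act_set_people_Diff intro!: exI[of _ \<pi>])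
qed

lemma hw_moves_iff:
  "(B, l) \<in> hw_moves n \<longleftrightarrow> hw_safe n B \<and> (head_count B, l) \<in> mc_moves n"
  using card_head_count[of B n] mc_safe_head_count[of n B]
  by (cases "head_count B") (auto simp: hw_moves_def mc_moves_def hw_safe_iff)

lemma move_orbit_eq:
  assumes "f \<in> hw_moves n"
  shows "move_orbit n f = {g \<in> hw_moves n. count_move g = count_move f}"
proof (intro equalityI subsetI)
  fix g assume "g \<in> move_orbit n f"
  then show "g \<in> {g \<in> hw_moves n. count_move g = count_move f}"
    using assms
    by (cases f) (auto simp: move_orbit_def hw_moves_iff hw_safe_act_set head_count_act_set)
next
  fix g assume g: "g \<in> {g \<in> hw_moves n. count_move g = count_move f}"
  obtain B l where f: "f = (B, l)" by (cases f)
  obtain B' l' where g': "g = (B', l')" by (cases g)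
  have "hw_safe n B" "hw_safe n B'" "head_count B = head_count B'" "l = l'"
    using assms g by (auto simp: hw_moves_iff f g')
  then show "g \<in> move_orbit n f"
    using ex_permutes_act_set[of n B B'] by (auto simp: move_orbit_def f g')
qed

section \<open>Lifting transitions\<close>

text \<open>The heart of lifting: counts that are safe on the boat and on both banks afterwards are
  realised by actual people. \<open>X\<close> is the bank the boat leaves and its complement the
  bank reached; the cases are whether none, all or only some of the husbands in \<open>X\<close>
  board.\<close>

lemma ex_safe_boarding:
  assumes X: "hw_safe n X" "hw_safe n (people n - X)"
    and cm: "head_count X = (c0, m0)" "c \<le> c0" "m \<le> m0" "mc_safe (c, m)"
    and safe: "mc_safe (c0 - c, m0 - m)" "mc_safe (n - (c0 - c), n - (m0 - m))"
  shows "\<exists>B. B \<subseteq> X \<and> hw_safe n B \<and> head_count B = (c, m) \<and> hw_safe n (X - B) \<and>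
    hw_safe n (people n - (X - B))"
proof -
  define W H where "W = Wife -` X" and "H = Husband -` X"
  \<comment> \<open>Complements reverse inclusion: safety of the other bank says that
    \<open>X\<close> has all husbands, or that each husband in \<open>X\<close> has his wife
    there.\<close>
  have WH: "W \<subseteq> {1..n}" "H \<subseteq> {1..n}" "H = {} \<or> W \<subseteq> H" "H = {1..n} \<or> H \<subseteq> W"
    using X unfolding hw_safe_iff subset_people_iff vimage_Diff vimage_people W_def H_def by blast+
  have fin: "finite W" "finite H" using WH by (auto intro: finite_subset)
  have card: "card W = c0" "card H = m0" using cm by (auto simp: head_count_def W_def H_def)
  have le: "c0 \<le> n" "m0 \<le> n" using card WH card_mono[of "{1..n}"] by fastforce+
  \<comment> \<open>The last three conjuncts are safety of the boat, of the bank left and of the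
    bank reached.\<close>
  have "\<exists>C M. C \<subseteq> W \<and> M \<subseteq> H \<and> card C = c \<and> card M = m \<and> (M = {} \<or> C \<subseteq> M) \<and>
    (H - M = {} \<or> W - C \<subseteq> H - M) \<and> (H - M = {1..n} \<or> H - M \<subseteq> W - C)"
  proof -
    consider "m = 0" | "m = m0" "m \<noteq> 0" | "0 < m" "m < m0" using cm by linarith
    then show ?thesis
    proof cases
      case 1
      obtain C where C: "C \<subseteq> W" "card C = c" using obtain_subset_with_card_n[of c W] cm card by blast
      \<comment> \<open>Only the bank reached needs care. If some but not all husbands are in
        \<open>X\<close>, then \<open>H = W\<close>, and since the other bank has a husband, its
        final counts force \<open>c = 0\<close>.\<close>
      have "H = {1..n} \<or> H \<subseteq> W - C"
      proof (cases "H = {} \<or> H = {1..n}")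
        case False
        then have "H = W" "c0 = m0" using WH card by auto
        have "m0 < n" using False WH card psubset_card_mono[of "{1..n}" H] by auto
        then have "c = 0" using safe(2) 1 cm \<open>c0 = m0\<close> le by auto
        then have "C = {}" using C fin finite_subset by fastforce
        then show ?thesis using \<open>H = W\<close> by simp
      qed auto
      moreover have "H = {} \<or> W - C \<subseteq> H" using WH(3) by blast
      ultimately show ?thesis using C 1 by (intro exI[of _ C] exI[of _ "{}"]) simp
    next
      case 2
      \<comment> \<open>All husbands of \<open>X\<close> leave: the bank left then has none and the
        bank reached has all \<open>n\<close>, so only the boat needs an argument.\<close>
      obtain C where C: "C \<subseteq> W" "card C = c" using obtain_subset_with_card_n[of c W] cm card by blast
      moreover from this have "H = {} \<or> C \<subseteq> H" using WH(3) by blast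
      ultimately show ?thesis using 2 card(2) by (intro exI[of _ C] exI[of _ H]) simp
    next
      case 3
      \<comment> \<open>Afterwards both banks have husbands, so both banks must consist of couples; choose the
        wives who stay and let exactly their husbands stay.\<close>
      then have "W \<subseteq> H" using WH card by auto
      have eq: "c0 - c = m0 - m" using safe 3 cm le by auto
      obtain K where K: "K \<subseteq> W" "card K = c0 - c"
        using obtain_subset_with_card_n[of "c0 - c" W] card by auto
      have "finite K" using K fin finite_subset by blast
      then have "card (W - K) = c" "card (H - K) = m"
        using K \<open>W \<subseteq> H\<close> card cm eq 3 by (subst card_Diff_subset; auto)+
      moreover have "W - (W - K) = K" "H - (H - K) = K" "W - K \<subseteq> H - K"
        using K(1) \<open>W \<subseteq> H\<close> by blast+
      ultimately show ?thesis by (intro exI[of _ "W - K"] exI[of _ "H - K"]) simp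
    qed
  qed
  then obtain C M where CM: "C \<subseteq> W" "M \<subseteq> H" "card C = c" "card M = m" "M = {} \<or> C \<subseteq> M"
    "H - M = {} \<or> W - C \<subseteq> H - M" "H - M = {1..n} \<or> H - M \<subseteq> W - C"
    by blast
  let ?B = "Wife ` C \<union> Husband ` M"
  have v: "Wife -` ?B = C" "Husband -` ?B = M" by auto
  have "?B \<subseteq> X" using CM by (auto simp: W_def H_def)
  moreover have "hw_safe n ?B" using CM(1,2,5) WH(1,2) unfolding hw_safe_iff subset_people_iff v by blast
  moreover have "head_count ?B = (c, m)" using CM unfolding head_count_def v by simp
  moreover have "hw_safe n (X - ?B)" using CM(6) WH(1,2)
    unfolding hw_safe_iff subset_people_iff vimage_Diff v W_def[symmetric] H_def[symmetric] by blast
  moreover have "hw_safe n (people n - (X - ?B))" using CM(7)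
    unfolding hw_safe_iff subset_people_iff vimage_Diff v W_def[symmetric] H_def[symmetric] vimage_people
    by blast
  ultimately show ?thesis by (intro exI[of _ ?B] conjI)
qed

section \<open>Head counts of states, moves and transitions\<close>

lemma head_count_people_Diff:
  "X \<subseteq> people n \<Longrightarrow> head_count (people n - X) = (n - fst (head_count X), n - snd (head_count X))"
  using head_count_Diff[of X "people n" n] by (simp add: head_count_people)

lemma count_state_in_mc_states:
  assumes "s \<in> hw_states n"
  shows "count_state s \<in> mc_states n"
proof -
  obtain L R l where s: "s = (L, R, l)" by (cases s)
  have L: "L \<subseteq> people n" "R = people n - L" "hw_safe n L" "hw_safe n R"
    using assms by (auto simp: hw_states_def s)
  moreover obtain c m where "head_count L = (c, m)" by (cases "head_count L")
  ultimately show ?thesis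
    using head_count_mono[of L "people n" n] mc_safe_head_count[of n L] mc_safe_head_count[of n R]
    by (auto simp: s mc_states_def head_count_people head_count_people_Diff)
qed

lemma ex_hw_state:
  assumes "t \<in> mc_states n"
  shows "\<exists>s \<in> hw_states n. count_state s = t"
proof -
  obtain c m l where t: "t = ((c, m), (n - c, n - m), l)" "c \<le> n" "m \<le> n" "mc_safe (c, m)"
    "mc_safe (n - c, n - m)"
    using assms by (auto simp: mc_states_def)
  with ex_safe_set[of c m n] obtain X where
    X: "hw_safe n X" "hw_safe n (people n - X)" "head_count X = (c, m)" by blast
  then have "X \<subseteq> people n" by (simp add: hw_safe_iff)
  with X t show ?thesis
    by (intro bexI[of _ "(X, people n - X, l)"]) (auto simp: hw_states_def head_count_people_Diff)
qed

text \<open>\<open>mc_moves\<close> does not bound \<open>c\<close> and \<open>m\<close> by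
  \<open>n\<close>; the hypothesis \<open>n > 1\<close> does, by keeping the boat capacity at most
  \<open>n\<close>. For \<open>n = 1\<close> a boat with two missionaries would have no
  counterpart.\<close>

lemma ex_hw_move:
  assumes "n > 1" "f \<in> mc_moves n"
  shows "\<exists>g \<in> hw_moves n. count_move g = f"
proof -
  obtain c m l where f: "f = ((c, m), l)" by (metis prod.exhaust)
  have "boat_capacity n \<le> n" using assms(1) by (simp add: boat_capacity_def)
  then have "mc_safe (c, m)" "c \<le> n" "m \<le> n" using assms f by (auto simp: mc_moves_def)
  with ex_safe_set[of c m n] obtain X where "hw_safe n X" "head_count X = (c, m)" by blast
  with assms f show ?thesis by (intro bexI[of _ "(X, l)"]) (auto simp: hw_moves_iff)
qed

text \<open>Counts subtract on the bank left because it contains the load, and add on the bank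
  reached because it is disjoint from the load.\<close>

lemma mc_transition_count:
  assumes "hw_transition n s f t"
  shows "mc_transition n (count_state s) (count_move f) (count_state t)"
proof -
  obtain L R l B k L' R' l' where eq: "s = (L, R, l)" "f = (B, k)" "t = (L', R', l')"
    by (metis prod.exhaust)
  have s: "s \<in> hw_states n" and t: "t \<in> hw_states n" and f: "f \<in> hw_moves n" "k = l" "l' \<noteq> l"
    using assms by (auto simp: eq)
  have LR: "L \<subseteq> people n" "R = people n - L" "R \<subseteq> people n" "L \<inter> R = {}"
    using s by (auto simp: hw_states_def eq)
  have mv: "if l = Left then B \<subseteq> L \<and> L' = L - B \<and> R' = R \<union> B else B \<subseteq> R \<and> R' = R - B \<and> L' = L \<union> B"
    using assms by (auto simp: eq)
  obtain cL mL cR mR c m where hc: "head_count L = (cL, mL)" "head_count R = (cR, mR)" "head_count B = (c, m)"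
    by (metis prod.exhaust)
  have mvs: "count_move f \<in> mc_moves n" using f by (auto simp: eq hw_moves_iff)
  note st = count_state_in_mc_states[OF s] count_state_in_mc_states[OF t]
  show ?thesis
  proof (cases "l = Left")
    case True
    with mv have B: "B \<subseteq> L" "L' = L - B" "R' = R \<union> B" by auto
    then have "R \<inter> B = {}" "B \<subseteq> people n" using LR by auto
    with B have "c \<le> cL" "m \<le> mL" "head_count L' = (cL - c, mL - m)" "head_count R' = (cR + c, mR + m)"
      using head_count_mono[of B L n] head_count_Diff[of B L n] head_count_Un[of R B n] LR hc by auto
    then show ?thesis
      using st mvs f(2,3) hc True by (simp add: eq)
  next
    case False
    with mv have B: "B \<subseteq> R" "R' = R - B" "L' = L \<union> B" by auto
    then have "L \<inter> B = {}" "B \<subseteq> people n" using LR by auto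
    with B have "c \<le> cR" "m \<le> mR" "head_count R' = (cR - c, mR - m)" "head_count L' = (cL + c, mL + m)"
      using head_count_mono[of B R n] head_count_Diff[of B R n] head_count_Un[of L B n] LR hc by auto
    then show ?thesis
      using st mvs f(2,3) hc False by (simp add: eq)
  qed
qed

text \<open>One-step lifting for \<open>is_path_lift\<close>: \<open>ex_safe_boarding\<close> is
  applied to the bank with the boat, and the other bank follows by complement.\<close>

lemma hw_transition_lift:
  assumes s: "s \<in> hw_states n" and tr: "mc_transition n (count_state s) f t"
  shows "\<exists>g s'. hw_transition n s g s' \<and> s' \<in> hw_states n \<and> count_move g = f \<and> count_state s' = t"
proof -
  obtain L R l where eq: "s = (L, R, l)" by (cases s)
  obtain c m k where f: "f = ((c, m), k)" by (metis prod.exhaust)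
  obtain cL' mL' cR' mR' l' where t: "t = ((cL', mL'), (cR', mR'), l')" by (metis prod.exhaust)
  obtain cL mL cR mR where hc: "head_count L = (cL, mL)" "head_count R = (cR, mR)" by (metis prod.exhaust)
  have LR: "L \<subseteq> people n" "people n - L = R" "people n - R = L" "R \<subseteq> people n" "hw_safe n L" "hw_safe n R"
    using s by (auto simp: hw_states_def eq)
  have "t \<in> mc_states n" using tr by (simp add: eq f t hc)
  \<comment> \<open>Complements are recorded in both directions, so that the last hypothesis of
    \<open>ex_safe_boarding\<close> becomes safety of the bank reached, whichever side the boat
    leaves.\<close>
  then have t': "mc_safe (cL', mL')" "mc_safe (cR', mR')" "n - cL' = cR'" "n - mL' = mR'"
    "n - cR' = cL'" "n - mR' = mL'"
    by (auto simp: mc_states_def t)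
  have mv: "f \<in> mc_moves n" "k = l" "l' \<noteq> l" using tr by (auto simp: eq f t hc)
  then have cm: "mc_safe (c, m)" by (auto simp: mc_moves_def f)
  show ?thesis
  proof (cases "l = Left")
    case True
    with tr have cm': "c \<le> cL" "m \<le> mL" "cL - c = cL'" "mL - m = mL'" by (auto simp: eq f t hc)
    obtain B where
      B: "B \<subseteq> L" "hw_safe n B" "head_count B = (c, m)" "hw_safe n (L - B)" "hw_safe n (people n - (L - B))"
      using ex_safe_boarding[of n L cL mL c m] LR hc cm cm' t' by auto
    moreover have L': "L - B \<subseteq> people n" "head_count (L - B) = (cL', mL')"
      using head_count_Diff[of B L n] B LR hc cm' by auto
    moreover have R': "people n - (L - B) = R \<union> B" using B LR by auto
    moreover have "head_count (R \<union> B) = (cR', mR')"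
      using head_count_people_Diff[OF L'(1)] L' R' t' by simp
    ultimately show ?thesis
      using s LR(5,6) mv True
      by (intro exI[of _ "(B, l)"] exI[of _ "(L - B, R \<union> B, l')"])
        (simp add: eq f t hw_states_def hw_moves_iff)
  next
    case False
    with tr have cm': "c \<le> cR" "m \<le> mR" "cR - c = cR'" "mR - m = mR'" by (auto simp: eq f t hc)
    obtain B where
      B: "B \<subseteq> R" "hw_safe n B" "head_count B = (c, m)" "hw_safe n (R - B)" "hw_safe n (people n - (R - B))"
      using ex_safe_boarding[of n R cR mR c m] LR hc cm cm' t' by auto
    moreover have R': "R - B \<subseteq> people n" "head_count (R - B) = (cR', mR')"
      using head_count_Diff[of B R n] B LR hc cm' by auto
    moreover have L': "people n - (R - B) = L \<union> B" using B LR by auto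
    \<comment> \<open>\<open>hw_states\<close> defines the right bank from the left, so here the
      bank left must be recovered as a complement.\<close>
    moreover have "people n - (L \<union> B) = R - B" "L \<union> B \<subseteq> people n" using B LR by auto
    moreover have "head_count (L \<union> B) = (cL', mL')"
      using head_count_people_Diff[OF R'(1)] L' R' t' by simp
    ultimately show ?thesis
      using s LR(5,6) mv False
      by (intro exI[of _ "(B, l)"] exI[of _ "(L \<union> B, R - B, l')"])
        (simp add: eq f t hw_states_def hw_moves_iff)
  qed
qed

section \<open>Orbit walks as relabelled MC paths\<close>

definition state_fibre :: "nat \<Rightarrow> mc_state \<Rightarrow> hw_state set" where
  "state_fibre n t = {s \<in> hw_states n. count_state s = t}"

definition move_fibre :: "nat \<Rightarrow> mc_move \<Rightarrow> hw_move set" where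
  "move_fibre n f = {g \<in> hw_moves n. count_move g = f}"

lemma hw_state_orbits_eq: "hw_state_orbits n = state_fibre n ` mc_states n"
proof -
  have "hw_state_orbits n = state_fibre n ` count_state ` hw_states n"
    unfolding hw_state_orbits_def image_image
    by (intro image_cong) (simp_all only: state_orbit_eq state_fibre_def)
  moreover have "count_state ` hw_states n = mc_states n"
    using count_state_in_mc_states ex_hw_state by blast
  ultimately show ?thesis by simp
qed

text \<open>Fibres over different counts are disjoint, so a representing path determines the orbits
  it passes through.\<close>

lemma state_orbit_unique:
  assumes "Q \<in> hw_state_orbits n" "s \<in> Q"
  shows "Q = state_fibre n (count_state s)"
proof -
  obtain t where "Q = state_fibre n t" using assms(1) unfolding hw_state_orbits_eq by blast
  then show ?thesis using assms(2) by (simp add: state_fibre_def)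
qed

lemma move_orbit_unique:
  assumes "F \<in> hw_move_orbits n" "f \<in> F"
  shows "F = move_fibre n (count_move f)"
proof -
  obtain g where "g \<in> hw_moves n" "F = move_orbit n g"
    using assms(1) unfolding hw_move_orbits_def by blast
  then show ?thesis using assms(2) by (simp add: move_orbit_eq move_fibre_def)
qed

text \<open>A representing HW path is counted into an MC path whose fibres are the given orbits.
  Conversely, the definition asks for a single HW path through all the orbits, and path lifting
  supplies it.\<close>

lemma hw_orbit_walks_eq:
  "hw_orbit_walks n =
    map_walk (state_fibre n) (move_fibre n) ` {p. is_path (mc_states n) (mc_transition n) p}"
proof (intro equalityI subsetI)
  fix w assume "w \<in> hw_orbit_walks n"
  then obtain Q Ps s xs where w: "w = (Q, Ps)" "Q \<in> hw_state_orbits n"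
    "set Ps \<subseteq> hw_move_orbits n \<times> hw_state_orbits n"
    and p: "is_path (hw_states n) (hw_transition n) (s, xs)" "s \<in> Q"
    and all: "list_all2 (\<lambda>(f, t) (F, T). f \<in> F \<and> t \<in> T) xs Ps"
    by (auto simp: hw_orbit_walks_def)
  let ?p = "map_walk count_state count_move (s, xs)"
  have "is_path (mc_states n) (mc_transition n) ?p"
    using count_state_in_mc_states mc_transition_count p(1) by (rule is_path_map_walk)
  \<comment> \<open>Each entry of \<open>xs\<close> lies in the matching entry of \<open>Ps\<close>,
    which by uniqueness is the fibre over the count of that entry.\<close>
  moreover have "Ps = map (map_prod (move_fibre n \<circ> count_move) (state_fibre n \<circ> count_state)) xs"
    using all w(3)
  proof (induction rule: list_all2_induct)
    case (Cons x xs y ys)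
    then have "fst x \<in> fst y" "snd x \<in> snd y" "fst y \<in> hw_move_orbits n" "snd y \<in> hw_state_orbits n"
      by (simp_all add: case_prod_beta mem_Times_iff)
    then have "fst y = move_fibre n (count_move (fst x))" "snd y = state_fibre n (count_state (snd x))"
      by (iprover intro: move_orbit_unique state_orbit_unique)+
    then have "y = map_prod (move_fibre n \<circ> count_move) (state_fibre n \<circ> count_state) x"
      by (simp add: prod_eq_iff)
    then show ?case using Cons by (simp add: o_def)
  qed simp
  then have "w = map_walk (state_fibre n) (move_fibre n) ?p"
    using state_orbit_unique[OF w(2) p(2)] unfolding w(1) map_walk_map_walk by (simp add: map_walk_def)
  ultimately show "w \<in> map_walk (state_fibre n) (move_fibre n) ` {p. is_path (mc_states n) (mc_transition n) p}"
    by blast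
next
  fix w assume "w \<in> map_walk (state_fibre n) (move_fibre n) ` {p. is_path (mc_states n) (mc_transition n) p}"
  then obtain p where p: "is_path (mc_states n) (mc_transition n) p"
    "w = map_walk (state_fibre n) (move_fibre n) p" by blast
  obtain s where s: "s \<in> hw_states n" "count_state s = fst p"
    using ex_hw_state is_path_start[OF p(1)] by blast
  then obtain xs where xs: "is_path (hw_states n) (hw_transition n) (s, xs)"
    "map_walk count_state count_move (s, xs) = p"
    using is_path_lift[where T = "hw_transition n", OF hw_transition_lift p(1) s] by blast
  have in_xs: "set xs \<subseteq> hw_moves n \<times> hw_states n"
    using is_path_walks_in[OF _ xs(1), of "hw_moves n"] by (auto simp: walks_in_def)
  have orb: "state_fibre n (count_state t) \<in> hw_state_orbits n" if "t \<in> hw_states n" for t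
    using that count_state_in_mc_states by (auto simp: hw_state_orbits_eq)
  have orbm: "move_fibre n (count_move f) \<in> hw_move_orbits n" if "f \<in> hw_moves n" for f
    using that by (auto simp: hw_move_orbits_def move_orbit_eq move_fibre_def)
  let ?Ps = "map (map_prod (move_fibre n \<circ> count_move) (state_fibre n \<circ> count_state)) xs"
  have "w = (state_fibre n (count_state s), ?Ps)"
    unfolding p(2) xs(2)[symmetric] map_walk_map_walk by (simp add: map_walk_def)
  \<comment> \<open>The lifted path represents the walk, as each entry lies in the fibre over its
    own count.\<close>
  moreover have "list_all2 (\<lambda>(f, t) (F, T). f \<in> F \<and> t \<in> T) xs ?Ps"
    using in_xs by (auto simp: list.rel_map state_fibre_def move_fibre_def intro!: list.rel_refl_strong)
  moreover have "set ?Ps \<subseteq> hw_move_orbits n \<times> hw_state_orbits n"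
  proof
    fix y assume "y \<in> set ?Ps"
    then obtain x where x: "x \<in> set xs"
      "y = map_prod (move_fibre n \<circ> count_move) (state_fibre n \<circ> count_state) x"
      unfolding set_map by (rule imageE)
    then have "fst x \<in> hw_moves n" "snd x \<in> hw_states n"
      using in_xs by (auto simp: mem_Times_iff)
    then show "y \<in> hw_move_orbits n \<times> hw_state_orbits n"
      using orb orbm x(2) by (simp add: mem_Times_iff)
  qed
  moreover have "s \<in> state_fibre n (count_state s)" using s by (simp add: state_fibre_def)
  ultimately show "w \<in> hw_orbit_walks n"
    unfolding hw_orbit_walks_def using orb[OF s(1)] xs(1) by blast
qed

theorem theorem3:
  fixes n :: nat
  assumes "n > 1"
  shows "equivalent_categories (Cat_HW_orbits n) (Cat_MC n)"
  unfolding Cat_HW_orbits_def Cat_MC_def hw_state_orbits_eq hw_orbit_walks_eq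
\<comment> \<open>The orbit category is now \<open>Cat_MC n\<close> relabelled by fibres.
  Injectivity holds because the fibres are nonempty and any member reveals the count; for moves,
  nonemptiness rests on \<open>n > 1\<close>.\<close>
proof (rule equivalent_relabelled_walk_cat)
  show "{p. is_path (mc_states n) (mc_transition n) p} \<subseteq> walks_in (mc_states n) (mc_moves n)"
    using is_path_walks_in[of "mc_transition n" "mc_moves n"] by auto
  show "inj_on (state_fibre n) (mc_states n)"
  proof (rule inj_onI)
    fix t t' assume "t \<in> mc_states n" "state_fibre n t = state_fibre n t'"
    moreover from this obtain s where "s \<in> hw_states n" "count_state s = t"
      using ex_hw_state by blast
    ultimately have "s \<in> state_fibre n t'" by (auto simp: state_fibre_def)
    then show "t = t'" using \<open>count_state s = t\<close> by (simp add: state_fibre_def)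
  qed
  show "inj_on (move_fibre n) (mc_moves n)"
  proof (rule inj_onI)
    fix f f' assume "f \<in> mc_moves n" "move_fibre n f = move_fibre n f'"
    moreover from this obtain g where "g \<in> hw_moves n" "count_move g = f"
      using ex_hw_move[OF assms] by blast
    ultimately have "g \<in> move_fibre n f'" by (auto simp: move_fibre_def)
    then show "f = f'" using \<open>count_move g = f\<close> by (simp add: move_fibre_def)
  qed
qed (auto simp: walk_single_def intro: is_path.single is_path_concat)

end
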